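(* Let $G$ be a simple, finite, connected graph with vertex set $V=\{v_1,\dots,v_n\}$ and let $M_G$ be a mixed graph with underlying graph $G$. Suppose $M_G$ has property $SP$. Then all cofactors of the Hermitian Laplacian matrix of the second kind $L(M_G)$ have the same absolute value, and this common absolute value equals the number of spanning trees of $G$.
   Context: A mixed graph $M_G$ is obtained from a simple graph $G$ (its underlying graph) by giving directions to some of the edges of $G$; an edge directed from $v_i$ to $v_j$ is written $v_i\to v_j$, an undirected edge $v_i\leftrightarrow v_j$. Let $\omega=\frac{1+\sqrt{3}\mathbf{i}}{2}$. The Hermitian adjacency matrix of the second kind is the $n\times n$ matrix $N(M_G)=(n_{ij})$ with $n_{ij}=1$ if $v_i\leftrightarrow v_j$, $n_{ij}=\omega$ if $v_i\to v_j$, $n_{ij}=\overline{\omega}=\frac{1-\sqrt{3}\mathbf{i}}{2}$ if $v_j\to v_i$, and $n_{ij}=0$ otherwise. With $D(M_G)$ the diagonal matrix of vertex degrees of $G$, the Hermitian Laplacian matrix of the second kind is $L(M_G)=D(M_G)-N(M_G)$. The $(i,j)$ cofactor is $(-1)^{i+j}\det$ of the submatrix obtained by deleting row $i$ and column $j$. The mixed graph $M_G$ has property $SP$ if $V$ can be partitioned into six (possibly empty) parts $V_1,\dots,V_6$ such that every undirected edge has both endpoints in the same part $V_i$, and every directed edge goes from some vertex of $V_i$ to some vertex of $V_{i+1}$ for some $i\in\{1,\dots,5\}$, or from a vertex of $V_6$ to a vertex of $V_1$. *)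

theory Defs
  imports Complex_Main "HOL-Library.Disjoint_Sets" "Jordan_Normal_Form.Determinant"
begin

text \<open>
  An undirected graph is a vertex set \<open>V\<close> with a set \<open>E\<close> of two-element edges. A mixed graph
  on it is given by the set \<open>A\<close> of those edges that have received a direction, \<open>(u, v) \<in> A\<close>
  standing for \<open>u \<rightarrow> v\<close>.
\<close>

definition simple_graph :: "'a set \<Rightarrow> 'a set set \<Rightarrow> bool" where
  "simple_graph V E \<longleftrightarrow> finite V \<and> (\<forall>e\<in>E. e \<subseteq> V \<and> card e = 2)"

definition graph_connected :: "'a set \<Rightarrow> 'a set set \<Rightarrow> bool" where
  "graph_connected V E \<longleftrightarrow>
     V \<noteq> {} \<and> (\<forall>u\<in>V. \<forall>v\<in>V. (u, v) \<in> {(x, y). {x, y} \<in> E}\<^sup>*)"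

definition graph_cycle :: "'a set set \<Rightarrow> 'a list \<Rightarrow> bool" where
  "graph_cycle E c \<longleftrightarrow> 3 \<le> length c \<and> distinct c \<and>
     (\<forall>i<length c. {c ! i, c ! ((i + 1) mod length c)} \<in> E)"

definition graph_tree :: "'a set \<Rightarrow> 'a set set \<Rightarrow> bool" where
  "graph_tree V T \<longleftrightarrow> graph_connected V T \<and> (\<nexists>c. graph_cycle T c)"

text \<open>A spanning tree is identified with its edge set. The spanning trees of Graph_Theory are not
  usable here: in the symmetric digraphs by which that library represents undirected graphs, every
  edge already forms a cycle of length two.\<close>

definition spanning_trees :: "'a set \<Rightarrow> 'a set set \<Rightarrow> 'a set set set" where
  "spanning_trees V E = {T. T \<subseteq> E \<and> graph_tree V T}"

definition vertex_degree :: "'a set set \<Rightarrow> 'a \<Rightarrow> nat" where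
  "vertex_degree E v = card {e \<in> E. v \<in> e}"

definition mixed_graph :: "'a set set \<Rightarrow> ('a \<times> 'a) set \<Rightarrow> bool" where
  "mixed_graph E A \<longleftrightarrow> (\<forall>(u, v)\<in>A. {u, v} \<in> E \<and> (v, u) \<notin> A)"

definition undirected_edge :: "'a set set \<Rightarrow> ('a \<times> 'a) set \<Rightarrow> 'a \<Rightarrow> 'a \<Rightarrow> bool" where
  "undirected_edge E A u v \<longleftrightarrow> {u, v} \<in> E \<and> (u, v) \<notin> A \<and> (v, u) \<notin> A"

definition omega :: complex where
  "omega = (1 + complex_of_real (sqrt 3) * \<i>) / 2"

text \<open>The list \<open>vs\<close> enumerates the vertices; matrix indices start at \<open>0\<close>.\<close>

definition hermitian_adjacency_2 :: "'a list \<Rightarrow> 'a set set \<Rightarrow> ('a \<times> 'a) set \<Rightarrow> complex mat" where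
  "hermitian_adjacency_2 vs E A = mat (length vs) (length vs) (\<lambda>(i, j).
     if undirected_edge E A (vs ! i) (vs ! j) then 1
     else if (vs ! i, vs ! j) \<in> A then omega
     else if (vs ! j, vs ! i) \<in> A then cnj omega
     else 0)"

definition degree_matrix :: "'a list \<Rightarrow> 'a set set \<Rightarrow> complex mat" where
  "degree_matrix vs E = mat (length vs) (length vs) (\<lambda>(i, j).
     if i = j then of_nat (vertex_degree E (vs ! i)) else 0)"

definition hermitian_laplacian_2 :: "'a list \<Rightarrow> 'a set set \<Rightarrow> ('a \<times> 'a) set \<Rightarrow> complex mat" where
  "hermitian_laplacian_2 vs E A = degree_matrix vs E - hermitian_adjacency_2 vs E A"

definition property_SP :: "'a set \<Rightarrow> 'a set set \<Rightarrow> ('a \<times> 'a) set \<Rightarrow> bool" where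
  "property_SP V E A \<longleftrightarrow> (\<exists>P :: nat \<Rightarrow> 'a set.
     (\<Union>k\<in>{1..6}. P k) = V \<and> disjoint_family_on P {1..6} \<and>
     (\<forall>u v. undirected_edge E A u v \<longrightarrow> (\<exists>k\<in>{1..6}. u \<in> P k \<and> v \<in> P k)) \<and>
     (\<forall>(u, v)\<in>A. (\<exists>k\<in>{1..5}. u \<in> P k \<and> v \<in> P (k + 1)) \<or> u \<in> P 6 \<and> v \<in> P 1))"

end

theory Submission
  imports Defs "HOL-Library.Transitive_Closure_Table"
begin

text \<open>
  Property SP makes \<open>L(M\<^sub>G)\<close> unitarily similar, by a diagonal matrix of powers of \<open>\<omega>\<close>, to the
  ordinary Laplacian of \<open>G\<close>, so cofactors keep their absolute values. The \<open>(r, j)\<close> cofactor of the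
  ordinary Laplacian is the determinant after replacing row \<open>r\<close> by the unit vector \<open>e\<^sub>j\<close>. Every other
  row \<open>v\<close> is the sum of \<open>e\<^sub>v - e\<^sub>w\<close> over the neighbours \<open>w\<close> of \<open>v\<close>; expanding multilinearly gives a
  sum over all functions \<open>f\<close> choosing a neighbour of each \<open>v \<noteq> r\<close>. The summand of \<open>f\<close> is \<open>1\<close> if
  iterating \<open>f\<close> leads from every vertex to \<open>r\<close>, and \<open>0\<close> otherwise. The functions of the first kind
  are exactly the spanning trees with all edges oriented towards \<open>r\<close>.
\<close>

section \<open>Spanning trees as parent maps\<close>

text \<open>A tree oriented towards \<open>r\<close>, stored as a total function. The values at
  \<open>r\<close> and outside \<open>V\<close> are pinned down so that each tree has exactly one
  representative and representatives can be counted. \<open>R\<close> is a parameter because the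
  count is taken both over vertices and over matrix indices.\<close>

definition parent_maps :: "'a set \<Rightarrow> ('a \<Rightarrow> 'a \<Rightarrow> bool) \<Rightarrow> 'a \<Rightarrow> ('a \<Rightarrow> 'a) set" where
  "parent_maps V R r = {p. p r = r \<and> (\<forall>v. v \<notin> V \<longrightarrow> p v = v) \<and>
     (\<forall>v\<in>V - {r}. p v \<in> V \<and> R v (p v)) \<and> (\<forall>v\<in>V. \<exists>k. (p ^^ k) v = r)}"

definition height :: "('a \<Rightarrow> 'a) \<Rightarrow> 'a \<Rightarrow> 'a \<Rightarrow> nat" where
  "height p r v = (LEAST k. (p ^^ k) v = r)"

lemma height_Suc:
  assumes "(p ^^ k) v = r" and "v \<noteq> r"
  shows "height p r v = Suc (height p r (p v))"
  unfolding height_def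
  by (subst Least_Suc[where P = "\<lambda>k. (p ^^ k) v = r", OF assms(1)])
    (use assms(2) in \<open>simp_all add: funpow_Suc_right del: funpow.simps(2)\<close>)

definition parent_edges :: "'a set \<Rightarrow> 'a \<Rightarrow> ('a \<Rightarrow> 'a) \<Rightarrow> 'a set set" where
  "parent_edges V r p = (\<lambda>v. {v, p v}) ` (V - {r})"

lemma rtrancl_parent_edges:
  assumes p: "p \<in> parent_maps V R r" and "v \<in> V"
  shows "(v, r) \<in> {(x, y). {x, y} \<in> parent_edges V r p}\<^sup>*"
proof -
  have "(p ^^ k) v = r \<Longrightarrow> v \<in> V \<Longrightarrow> ?thesis" for k
  proof (induction k arbitrary: v)
    case (Suc k)
    show ?case
    proof (cases "v = r")
      case False
      have "(p ^^ k) (p v) = r"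
        using Suc.prems by (simp add: funpow_Suc_right del: funpow.simps(2))
      moreover have "p v \<in> V" using p Suc.prems False by (auto simp: parent_maps_def)
      ultimately have "(p v, r) \<in> {(x, y). {x, y} \<in> parent_edges V r p}\<^sup>*"
        by (rule Suc.IH)
      moreover have "(v, p v) \<in> {(x, y). {x, y} \<in> parent_edges V r p}"
        using Suc.prems False by (auto simp: parent_edges_def)
      ultimately show ?thesis by (rule converse_rtrancl_into_rtrancl[rotated])
    qed simp
  qed simp
  then show ?thesis using assms by (auto simp: parent_maps_def)
qed

lemma graph_connected_parent_edges:
  assumes p: "p \<in> parent_maps V R r" and r: "r \<in> V"
  shows "graph_connected V (parent_edges V r p)"
proof -
  let ?S = "{(x, y). {x, y} \<in> parent_edges V r p}"
  have "sym ?S" by (auto simp: sym_def insert_commute)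
  then have "sym (?S\<^sup>*)" by (rule sym_rtrancl)
  then have "(u, v) \<in> ?S\<^sup>*" if "u \<in> V" "v \<in> V" for u v
    using rtrancl_parent_edges[OF p that(1)] rtrancl_parent_edges[OF p that(2)]
    by (meson rtrancl_trans symD)
  then show ?thesis using r by (auto simp: graph_connected_def)
qed

text \<open>An edge has the form \<open>{v, p v}\<close>, and the heights of its ends differ by
  exactly one, so an end at least as high as the other must be the child \<open>v\<close>.\<close>

lemma parent_edge_lower:
  assumes p: "p \<in> parent_maps V R r" and e: "{x, y} \<in> parent_edges V r p"
    and h: "height p r y \<le> height p r x"
  shows "y = p x"
proof -
  obtain v where v: "v \<in> V" "v \<noteq> r" "{x, y} = {v, p v}"
    using e by (auto simp: parent_edges_def)
  obtain k where "(p ^^ k) v = r" using p v by (auto simp: parent_maps_def)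
  then have "height p r v = Suc (height p r (p v))" using v(2) by (rule height_Suc)
  then have "x = v" using v(3) h by (auto simp: doubleton_eq_iff)
  then show ?thesis using v(3) by (auto simp: doubleton_eq_iff)
qed

text \<open>Both neighbours of a highest vertex on a cycle would have to be its parent.\<close>

lemma no_cycle_parent_edges:
  assumes p: "p \<in> parent_maps V R r"
  shows "\<not> graph_cycle (parent_edges V r p) c"
proof
  assume "graph_cycle (parent_edges V r p) c"
  then have len: "3 \<le> length c" and dist: "distinct c"
    and edge: "\<And>i. i < length c \<Longrightarrow> {c ! i, c ! ((i + 1) mod length c)} \<in> parent_edges V r p"
    by (auto simp: graph_cycle_def)
  define n where "n = length c"
  have "\<exists>i<n. \<forall>j<n. height p r (c ! j) \<le> height p r (c ! i)"
  proof -
    let ?H = "(\<lambda>i. height p r (c ! i)) ` {..<n}"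
    have "Max ?H \<in> ?H" using len by (intro Max_in) (auto simp: n_def lessThan_empty_iff)
    then obtain i where "i < n" "Max ?H = height p r (c ! i)" by auto
    moreover have "height p r (c ! j) \<le> Max ?H" if "j < n" for j using that by auto
    ultimately show ?thesis by auto
  qed
  then obtain i where i: "i < n" and imax: "\<And>j. j < n \<Longrightarrow> height p r (c ! j) \<le> height p r (c ! i)"
    by blast
  \<comment> \<open>\<open>j\<close> and \<open>k\<close> are the cyclic successor and predecessor
    of \<open>i\<close>. They differ because the cycle has length at least three.\<close>
  define j where "j = (i + 1) mod n"
  define k where "k = (if i = 0 then n - 1 else i - 1)"
  have jk: "j < n" "k < n" "j \<noteq> k" "(k + 1) mod n = i"
    using i len by (auto simp: j_def k_def n_def mod_Suc)
  have "c ! j = p (c ! i)"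
    using parent_edge_lower[OF p _ imax[OF jk(1)]] edge[of i] i by (simp add: j_def n_def)
  moreover have "c ! k = p (c ! i)"
    using parent_edge_lower[OF p _ imax[OF jk(2)]] edge[of k] jk by (simp add: n_def insert_commute)
  ultimately show False using dist jk by (metis n_def nth_eq_iff_index_eq)
qed

text \<open>Induction on the height of \<open>v\<close>. If \<open>q\<close> used the edge
  \<open>{v, p v}\<close> in the opposite direction, the induction hypothesis at the lower vertex
  \<open>p v\<close> would give \<open>p (p v) = v\<close>, and each of the two vertices would be
  higher than the other.\<close>

lemma inj_on_parent_edges: "inj_on (parent_edges V r) (parent_maps V R r)"
proof
  fix p q assume p: "p \<in> parent_maps V R r" and q: "q \<in> parent_maps V R r"
    and eq: "parent_edges V r p = parent_edges V r q"
  have "v \<in> V \<Longrightarrow> p v = q v" for v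
  proof (induction "height p r v" arbitrary: v rule: less_induct)
    case less
    show ?case
    proof (cases "v = r")
      case True
      then show ?thesis using p q by (auto simp: parent_maps_def)
    next
      case False
      obtain k where "(p ^^ k) v = r" using p less.prems by (auto simp: parent_maps_def)
      then have h: "height p r v = Suc (height p r (p v))" using False by (rule height_Suc)
      have "{v, p v} \<in> parent_edges V r q"
        using eq less.prems False by (auto simp: parent_edges_def)
      then obtain w where w: "w \<in> V" "w \<noteq> r" "{v, p v} = {w, q w}"
        by (auto simp: parent_edges_def)
      show ?thesis
      proof (cases "v = w")
        case True
        then show ?thesis using w(3) by (auto simp: doubleton_eq_iff)
      next
        case False
        then have "p v = w" "q w = v" using w(3) by (auto simp: doubleton_eq_iff)
        then have "p w = v" using less.hyps[of w] h w by simp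
        obtain l where "(p ^^ l) w = r" using p w by (auto simp: parent_maps_def)
        then have "height p r w = Suc (height p r (p w))" using w(2) by (rule height_Suc)
        then have "height p r w = Suc (height p r v)" using \<open>p w = v\<close> by simp
        then show ?thesis using h \<open>p v = w\<close> by simp
      qed
    qed
  qed
  moreover have "v \<notin> V \<Longrightarrow> p v = q v" for v using p q by (simp add: parent_maps_def)
  ultimately show "p = q" by blast
qed

text \<open>The construction is a breadth-first tree: \<open>d\<close> is the distance to
  \<open>r\<close>, and each other vertex takes as parent a neighbour strictly closer to
  \<open>r\<close>.\<close>

lemma parent_map_of_connected:
  assumes conn: "graph_connected V T" and sub: "\<forall>e\<in>T. e \<subseteq> V" and r: "r \<in> V"
  shows "parent_maps V (\<lambda>u v. {u, v} \<in> T) r \<noteq> {}"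
proof -
  let ?S = "{(x, y). {x, y} \<in> T}"
  define d where "d v = (LEAST k. (v, r) \<in> ?S ^^ k)" for v
  have "\<exists>w. {v, w} \<in> T \<and> d w < d v" if v: "v \<in> V" "v \<noteq> r" for v
  proof -
    have "(v, r) \<in> ?S\<^sup>*" using conn v r by (auto simp: graph_connected_def)
    then obtain k where "(v, r) \<in> ?S ^^ k" by (auto simp: rtrancl_power)
    then have dv: "(v, r) \<in> ?S ^^ d v" unfolding d_def by (rule LeastI)
    then obtain m where m: "d v = Suc m" using v by (cases "d v") auto
    then obtain w where w: "{v, w} \<in> T" "(w, r) \<in> ?S ^^ m"
      using dv relpow_Suc_D2[of v r m ?S] by auto
    then have "d w \<le> m" unfolding d_def by (intro Least_le)
    then show ?thesis using w m by auto
  qed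
  then obtain q where q: "\<And>v. v \<in> V \<Longrightarrow> v \<noteq> r \<Longrightarrow> {v, q v} \<in> T \<and> d (q v) < d v" by metis
  define p where "p v = (if v \<in> V \<and> v \<noteq> r then q v else v)" for v
  have pV: "p v \<in> V" if "v \<in> V" for v
    using q[of v] that sub by (fastforce simp: p_def)
  have "v \<in> V \<Longrightarrow> \<exists>k. (p ^^ k) v = r" for v
  proof (induction "d v" arbitrary: v rule: less_induct)
    case less
    show ?case
    proof (cases "v = r")
      case True
      then have "(p ^^ 0) v = r" by simp
      then show ?thesis by blast
    next
      case False
      then have "d (p v) < d v" using q[of v] less.prems by (simp add: p_def)
      then obtain k where "(p ^^ k) (p v) = r" using less.hyps pV less.prems by blast
      then have "(p ^^ Suc k) v = r" by (simp add: funpow_Suc_right del: funpow.simps(2))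
      then show ?thesis by blast
    qed
  qed
  then have "p \<in> parent_maps V (\<lambda>u v. {u, v} \<in> T) r"
    using q pV by (simp add: parent_maps_def) (auto simp: p_def)
  then show ?thesis by blast
qed

lemma rtrancl_path_nth_edge:
  "rtrancl_path Q x xs y \<Longrightarrow> i < length xs \<Longrightarrow> Q ((x # xs) ! i) (xs ! i)"
  by (induction arbitrary: i rule: rtrancl_path.induct) (auto simp: nth_Cons split: nat.splits)

lemma rtrancl_path_last: "rtrancl_path Q x xs y \<Longrightarrow> last (x # xs) = y"
  by (induction rule: rtrancl_path.induct) auto

text \<open>A simple path from \<open>x\<close> to \<open>y\<close> inside \<open>T'\<close>, closed
  up by the edge \<open>{x, y}\<close>, is the required cycle.\<close>

lemma cycle_of_chord:
  assumes sub: "T' \<subseteq> T" and path: "(x, y) \<in> {(x, y). {x, y} \<in> T'}\<^sup>*"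
    and xy: "{x, y} \<in> T" "{x, y} \<notin> T'" "x \<noteq> y"
  shows "\<exists>c. graph_cycle T c"
proof -
  let ?Q = "\<lambda>x y. {x, y} \<in> T'"
  have "?Q\<^sup>*\<^sup>* x y" using path by (simp add: rtranclp_rtrancl_eq)
  then obtain xs0 where "rtrancl_path ?Q x xs0 y" by (auto simp: rtranclp_eq_rtrancl_path)
  then obtain xs where xs: "rtrancl_path ?Q x xs y" and dist: "distinct (x # xs)"
    by (rule rtrancl_path_distinct)
  note nth = rtrancl_path_nth_edge[OF xs]
  have last: "last (x # xs) = y" using xs by (rule rtrancl_path_last)
  have "xs \<noteq> []" using last xy by auto
  \<comment> \<open>A one-step path would put the chord itself into \<open>T'\<close>. With at least
    two steps, \<open>x # xs\<close> has the three vertices that \<open>graph_cycle\<close>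
    demands.\<close>
  have "length xs \<noteq> 1"
  proof
    assume "length xs = 1"
    then obtain z where "xs = [z]" by (auto simp: length_Suc_conv)
    then show False using last nth[of 0] xy by simp
  qed
  with \<open>xs \<noteq> []\<close> have len: "2 \<le> length xs" by (cases xs; cases "tl xs") auto
  have "{(x # xs) ! i, (x # xs) ! ((i + 1) mod length (x # xs))} \<in> T" if "i < length (x # xs)" for i
  proof (cases "i = length xs")
    case True
    then have "(x # xs) ! i = y" using last last_conv_nth[of "x # xs"] by simp
    then show ?thesis using True xy by (simp add: insert_commute)
  next
    case False
    then have "i < length xs" using that by simp
    then show ?thesis using nth[of i] sub by auto
  qed
  then have "graph_cycle T (x # xs)" using len dist by (simp add: graph_cycle_def)
  then show ?thesis by blast
qed

text \<open>For surjectivity, choose a parent map inside the tree \<open>T\<close>. Its edges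
  already connect \<open>V\<close>, so any further edge of \<open>T\<close> would be a chord closing
  a cycle in \<open>T\<close>.\<close>

lemma bij_betw_parent_edges:
  assumes G: "simple_graph V E" and r: "r \<in> V"
  shows "bij_betw (parent_edges V r) (parent_maps V (\<lambda>u v. {u, v} \<in> E) r) (spanning_trees V E)"
proof -
  have "parent_edges V r p \<in> spanning_trees V E"
    if p: "p \<in> parent_maps V (\<lambda>u v. {u, v} \<in> E) r" for p
    using graph_connected_parent_edges[OF p r] no_cycle_parent_edges[OF p] p
    by (auto simp: spanning_trees_def graph_tree_def parent_edges_def parent_maps_def)
  moreover have "T \<in> parent_edges V r ` parent_maps V (\<lambda>u v. {u, v} \<in> E) r"
    if "T \<in> spanning_trees V E" for T
  proof -
    have T: "T \<subseteq> E" "graph_connected V T" "\<nexists>c. graph_cycle T c"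
      using that by (auto simp: spanning_trees_def graph_tree_def)
    have edge: "e \<subseteq> V \<and> card e = 2" if "e \<in> T" for e
      using that T(1) G by (auto simp: simple_graph_def)
    then obtain p where p: "p \<in> parent_maps V (\<lambda>u v. {u, v} \<in> T) r"
      using parent_map_of_connected[OF T(2) _ r] by blast
    have sub: "parent_edges V r p \<subseteq> T" using p by (auto simp: parent_edges_def parent_maps_def)
    moreover have "T \<subseteq> parent_edges V r p"
    proof
      fix e assume e: "e \<in> T"
      then obtain x y where xy: "e = {x, y}" "x \<noteq> y" using edge by (meson card_2_iff)
      show "e \<in> parent_edges V r p"
      proof (rule ccontr)
        assume "e \<notin> parent_edges V r p"
        moreover have "(x, y) \<in> {(x, y). {x, y} \<in> parent_edges V r p}\<^sup>*"
          using graph_connected_parent_edges[OF p r] edge[OF e] xy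
          by (auto simp: graph_connected_def)
        ultimately show False using cycle_of_chord[OF sub] e xy T(3) by blast
      qed
    qed
    moreover have "p \<in> parent_maps V (\<lambda>u v. {u, v} \<in> E) r"
      using p T(1) by (auto simp: parent_maps_def)
    ultimately show ?thesis by blast
  qed
  ultimately show ?thesis
    using inj_on_parent_edges by (auto simp: bij_betw_def)
qed

section \<open>Transport of parent maps along bijections\<close>

lemma finite_parent_maps:
  assumes "finite V"
  shows "finite (parent_maps V R r)"
proof (rule finite_subset)
  show "parent_maps V R r \<subseteq>
      {p. (\<forall>v\<in>V. p v \<in> insert r V) \<and> (\<forall>v. v \<notin> V \<longrightarrow> p v = v)}"
    by (auto simp: parent_maps_def)
  show "finite {p. (\<forall>v\<in>V. p v \<in> insert r V) \<and> (\<forall>v. v \<notin> V \<longrightarrow> p v = v)}"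
    using assms by (intro finite_bounded_functions) auto
qed

text \<open>Conjugation with \<open>h\<close>, continued by the identity outside \<open>W\<close>,
  is injective and carries iterates to iterates, so reaching \<open>r\<close> becomes reaching
  \<open>h r\<close>.\<close>

lemma card_parent_maps_le:
  assumes h: "bij_betw h V W" and r: "r \<in> V" and fin: "finite V"
    and R: "\<And>u v. u \<in> V \<Longrightarrow> v \<in> V \<Longrightarrow> R u v \<Longrightarrow> Q (h u) (h v)"
  shows "card (parent_maps V R r) \<le> card (parent_maps W Q (h r))"
proof (rule card_inj_on_le)
  define g where "g = inv_into V h"
  have gh: "g (h v) = v" if "v \<in> V" for v
    using h that by (simp add: g_def bij_betw_def)
  have W: "W = h ` V" using h by (simp add: bij_betw_def)
  define F where "F p w = (if w \<in> W then h (p (g w)) else w)" for p w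
  have Fh: "F p (h v) = h (p v)" if "v \<in> V" for p v using that gh by (auto simp: F_def W)
  show "inj_on F (parent_maps V R r)"
  proof
    fix p q assume p: "p \<in> parent_maps V R r" and q: "q \<in> parent_maps V R r" and eq: "F p = F q"
    have "p v = q v" for v
    proof (cases "v \<in> V")
      case True
      then have "h (p v) = h (q v)" using Fh[of v p] Fh[of v q] eq by simp
      moreover have "p v \<in> V" "q v \<in> V" using p q True r by (cases "v = r"; auto simp: parent_maps_def)+
      ultimately show ?thesis using gh by metis
    qed (use p q in \<open>auto simp: parent_maps_def\<close>)
    then show "p = q" by blast
  qed
  show "F ` parent_maps V R r \<subseteq> parent_maps W Q (h r)"
  proof
    fix f assume "f \<in> F ` parent_maps V R r"
    then obtain p where p: "p \<in> parent_maps V R r" and f: "f = F p" by blast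
    have pV: "p v \<in> V" if "v \<in> V" for v using p that r by (cases "v = r") (auto simp: parent_maps_def)
    have pow: "v \<in> V \<Longrightarrow> (F p ^^ k) (h v) = h ((p ^^ k) v) \<and> (p ^^ k) v \<in> V" for k v
      by (induction k) (auto simp: Fh pV)
    have "\<exists>k. (F p ^^ k) w = h r" if w: "w \<in> W" for w
    proof -
      obtain v where "v \<in> V" "w = h v" using w W by auto
      moreover then obtain k where "(p ^^ k) v = r" using p by (auto simp: parent_maps_def)
      ultimately have "(F p ^^ k) w = h r" using pow by metis
      then show ?thesis by blast
    qed
    moreover have "F p w \<in> W \<and> Q w (F p w)" if w: "w \<in> W - {h r}" for w
    proof -
      obtain v where v: "v \<in> V" "w = h v" "v \<noteq> r" using w W by auto
      then have "R v (p v)" using p by (auto simp: parent_maps_def)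
      then show ?thesis using v R pV by (auto simp: Fh W)
    qed
    moreover have "F p (h r) = h r" using p Fh[OF r] by (simp add: parent_maps_def)
    ultimately show "f \<in> parent_maps W Q (h r)" unfolding f parent_maps_def
      by (auto simp: F_def)
  qed
  show "finite (parent_maps W Q (h r))" using fin W by (intro finite_parent_maps) auto
qed

text \<open>Apply the inequality to \<open>h\<close> and to its inverse. This converts the count
  over matrix indices, which the cofactor yields, into a count over vertices.\<close>

lemma card_parent_maps_cong:
  assumes h: "bij_betw h V W" and r: "r \<in> V" and fin: "finite V"
    and R: "\<And>u v. u \<in> V \<Longrightarrow> v \<in> V \<Longrightarrow> R u v \<longleftrightarrow> Q (h u) (h v)"
  shows "card (parent_maps V R r) = card (parent_maps W Q (h r))"
proof (rule antisym)
  show "card (parent_maps V R r) \<le> card (parent_maps W Q (h r))"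
    using card_parent_maps_le[OF h r fin, of R Q] R by blast
  let ?g = "inv_into V h"
  have hW: "h ` V = W" using h by (simp add: bij_betw_def)
  have "card (parent_maps W Q (h r)) \<le> card (parent_maps V R (?g (h r)))"
  proof (rule card_parent_maps_le)
    show "bij_betw ?g W V" using h by (rule bij_betw_inv_into)
    show "h r \<in> W" "finite W" using r fin hW by auto
    show "R (?g u) (?g v)" if "u \<in> W" "v \<in> W" "Q u v" for u v
      using that hW by (subst R) (auto simp: inv_into_into f_inv_into_f)
  qed
  then show "card (parent_maps W Q (h r)) \<le> card (parent_maps V R r)"
    using h r by (simp add: bij_betw_def)
qed


section \<open>Determinants of functional matrices\<close>

text \<open>In terms of unit vectors, row \<open>r\<close> is \<open>e\<^sub>j\<close> and every other row \<open>a\<close> is \<open>e\<^sub>a - e\<^bsub>f a\<^esub>\<close>.\<close>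

definition functional_mat :: "nat \<Rightarrow> nat \<Rightarrow> nat \<Rightarrow> (nat \<Rightarrow> nat) \<Rightarrow> 'a :: comm_ring_1 mat" where
  "functional_mat n r j f = mat n n (\<lambda>(a, b).
     if a = r then of_bool (b = j) else of_bool (b = a) - of_bool (b = f a))"

lemma functional_mat_carrier: "functional_mat n r j f \<in> carrier_mat n n"
  by (simp add: functional_mat_def)

text \<open>A permutation contributing to the determinant moves each vertex to itself or to its image;
  if it is not the identity, a moved vertex of maximal height is the image of a higher one.\<close>

lemma det_functional_mat_root:
  assumes r: "r < n" and reach: "\<forall>a<n. \<exists>k. (f ^^ k) a = r"
  shows "det (functional_mat n r r f) = (1 :: 'a :: comm_ring_1)"
proof -
  let ?M = "functional_mat n r r f :: 'a mat"
  have height: "height f r a = Suc (height f r (f a))" if "a < n" "a \<noteq> r" for a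
    using reach that height_Suc by metis
  have zero: "(\<Prod>a = 0..<n. ?M $$ (a, q a)) = 0" if q: "q permutes {0..<n}" and "q \<noteq> id" for q
  proof (rule ccontr)
    assume nz: "(\<Prod>a = 0..<n. ?M $$ (a, q a)) \<noteq> 0"
    have qn: "q a < n" if "a < n" for a using permutes_in_image[OF q, of a] that by simp
    have move: "a \<noteq> r \<and> q a = f a" if "a < n" "q a \<noteq> a" for a
    proof -
      have "?M $$ (a, q a) \<noteq> 0"
      proof
        assume "?M $$ (a, q a) = 0"
        then have "(\<Prod>a = 0..<n. ?M $$ (a, q a)) = 0" using that(1) by (intro prod_zero) auto
        with nz show False ..
      qed
      then show ?thesis using that qn[of a] by (auto simp: functional_mat_def split: if_splits)
    qed
    let ?S = "{a \<in> {0..<n}. q a \<noteq> a}"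
    have "\<exists>a. q a \<noteq> a" using \<open>q \<noteq> id\<close> by (auto simp: fun_eq_iff)
    then have "?S \<noteq> {}" using q by (auto simp: permutes_def)
    then have "Max (height f r ` ?S) \<in> height f r ` ?S" by (intro Max_in) auto
    then obtain a where a: "a \<in> ?S" and "height f r a = Max (height f r ` ?S)" by force
    then have amax: "height f r b \<le> height f r a" if "b \<in> ?S" for b using that by simp
    obtain b where b: "q b = a" using permutes_surj[OF q] by (metis surj_def)
    then have "b \<in> {0..<n}" using a q by (metis (no_types, lifting) mem_Collect_eq permutes_in_image)
    moreover have "q b \<noteq> b" using a b by auto
    ultimately have "b \<in> ?S" "f b = a" "b \<noteq> r" "b < n" using move[of b] b by auto
    then show False using height[of b] amax[of b] by simp
  qed
  \<comment> \<open>Off row \<open>r\<close> the entry is 1 minus the indicator of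
    \<open>f a = a\<close>, and a fixed point other than \<open>r\<close> would be higher than
    itself.\<close>
  have diag: "?M $$ (a, a) = 1" if "a < n" for a
    using that height[of a] by (auto simp: functional_mat_def)
  have "det ?M = (\<Sum>q | q permutes {0..<n}. signof q * (\<Prod>a = 0..<n. ?M $$ (a, q a)))"
    by (rule det_def'[OF functional_mat_carrier])
  also have "\<dots> = (\<Sum>q\<in>{id}. signof q * (\<Prod>a = 0..<n. ?M $$ (a, q a)))"
    by (rule sum.mono_neutral_right) (auto simp: zero permutes_id finite_permutations)
  also have "\<dots> = 1" using diag by simp
  finally show ?thesis .
qed

text \<open>Adding row \<open>j\<close>, which is \<open>e_j - e_(f j)\<close>, to a row
  \<open>r\<close> equal to \<open>e_(f j)\<close> turns the latter into \<open>e_j\<close>. So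
  \<open>j\<close> may be replaced by \<open>f j\<close> without changing the determinant, until it
  arrives at \<open>r\<close>.\<close>

lemma det_functional_mat_reaching:
  assumes r: "r < n" and reach: "\<forall>a<n. \<exists>k. (f ^^ k) a = r" and f: "\<forall>a<n. f a < n"
    and j: "j < n"
  shows "det (functional_mat n r j f) = (1 :: 'a :: comm_ring_1)"
proof -
  have "(f ^^ k) j = r \<Longrightarrow> j < n \<Longrightarrow> det (functional_mat n r j f) = (1 :: 'a)" for k
  proof (induction k arbitrary: j)
    case 0
    then show ?case using det_functional_mat_root[OF r reach] by simp
  next
    case (Suc k)
    show ?case
    proof (cases "j = r")
      case True
      then show ?thesis using det_functional_mat_root[OF r reach] by simp
    next
      case False
      have "functional_mat n r j f = addrow (1 :: 'a) r j (functional_mat n r (f j) f)"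
        using Suc.prems False by (intro eq_matI) (auto simp: functional_mat_def mat_addrow_def)
      then have "det (functional_mat n r j f) = det (functional_mat n r (f j) f :: 'a mat)"
        using det_addrow[OF Suc.prems(2) False[symmetric] functional_mat_carrier, of "1 :: 'a"] by metis
      also have "\<dots> = 1"
        using Suc.prems f by (intro Suc.IH) (auto simp: funpow_Suc_right simp del: funpow.simps(2))
      finally show ?thesis .
    qed
  qed
  then show ?thesis using reach j by blast
qed

text \<open>The indicator of the vertices that never reach \<open>r\<close>, shifted by a constant so as to vanish
  at \<open>j\<close>, is a kernel vector.\<close>

lemma det_functional_mat_not_reaching:
  assumes r: "r < n" and f: "\<forall>a<n. f a < n" and a: "a < n" "\<nexists>k. (f ^^ k) a = r" and j: "j < n"
  shows "det (functional_mat n r j f) = (0 :: 'a :: idom)"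
proof -
  let ?M = "functional_mat n r j f :: 'a mat"
  define x where "x b = (of_bool (\<nexists>k. (f ^^ k) b = r) :: 'a)" for b
  have x_step: "x (f b) = x b" if "b \<noteq> r" for b
  proof -
    have "(\<exists>k. (f ^^ k) b = r) \<longleftrightarrow> (\<exists>k. (f ^^ k) (f b) = r)"
    proof
      assume "\<exists>k. (f ^^ k) b = r"
      then obtain k where "(f ^^ k) b = r" by blast
      then show "\<exists>k. (f ^^ k) (f b) = r"
        using that by (cases k) (auto simp: funpow_Suc_right simp del: funpow.simps(2))
    next
      assume "\<exists>k. (f ^^ k) (f b) = r"
      then obtain k where "(f ^^ Suc k) b = r"
        by (auto simp: funpow_Suc_right simp del: funpow.simps(2))
      then show "\<exists>k. (f ^^ k) b = r" by blast
    qed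
    then show ?thesis by (simp add: x_def)
  qed
  have "\<exists>k. (f ^^ k) r = r" by (rule exI[of _ 0]) simp
  then have "x r = 0" by (simp add: x_def)
  have "x a = 1" using a by (simp add: x_def)
  define v where "v = vec n (\<lambda>b. x b - x j)"
  \<comment> \<open>\<open>x\<close> takes different values at \<open>r\<close> and
    \<open>a\<close>, so no constant shift makes it vanish at both.\<close>
  have "v \<noteq> 0\<^sub>v n"
  proof
    assume "v = 0\<^sub>v n"
    then have "v $ r = 0" "v $ a = 0" using r a by auto
    then show False using r a \<open>x r = 0\<close> \<open>x a = 1\<close> by (simp add: v_def)
  qed
  \<comment> \<open>Row \<open>r\<close> reads off the entry at \<open>j\<close>, which the shift
    has made 0; any other row \<open>b\<close> compares the entries at \<open>b\<close> and
    \<open>f b\<close>.\<close>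
  moreover have "?M *\<^sub>v v = 0\<^sub>v n"
  proof (rule eq_vecI)
    fix b assume "b < dim_vec (0\<^sub>v n :: 'a vec)"
    then have b: "b < n" by simp
    have "(?M *\<^sub>v v) $ b = (\<Sum>c = 0..<n. ?M $$ (b, c) * (x c - x j))"
      using b by (simp add: functional_mat_def scalar_prod_def v_def)
    also have "\<dots> = 0"
    proof (cases "b = r")
      case True
      then have "(\<Sum>c = 0..<n. ?M $$ (b, c) * (x c - x j)) = (\<Sum>c = 0..<n. if c = j then x c - x j else 0)"
        using b by (intro sum.cong) (auto simp: functional_mat_def)
      then show ?thesis by simp
    next
      case False
      then have "(\<Sum>c = 0..<n. ?M $$ (b, c) * (x c - x j)) =
          (\<Sum>c = 0..<n. (if c = b then x c - x j else 0) - (if c = f b then x c - x j else 0))"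
        using b by (intro sum.cong) (auto simp: functional_mat_def)
      also have "\<dots> = (x b - x j) - (x (f b) - x j)"
        using b f by (simp add: sum_subtractf)
      finally show ?thesis using x_step[OF False] by simp
    qed
    finally show "(?M *\<^sub>v v) $ b = 0\<^sub>v n $ b" using b by simp
  qed (simp add: functional_mat_def)
  moreover have "v \<in> carrier_vec n" by (simp add: v_def)
  ultimately show ?thesis using det_0_iff_vec_prod_zero[OF functional_mat_carrier] by blast
qed

section \<open>Cofactors of the ordinary Laplacian\<close>

text \<open>For irreflexive \<open>R\<close> this is the out-degree Laplacian of a digraph; for a
  symmetric one it is the usual graph Laplacian.\<close>

definition laplacian_mat :: "nat \<Rightarrow> (nat \<Rightarrow> nat \<Rightarrow> bool) \<Rightarrow> 'a :: comm_ring_1 mat" where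
  "laplacian_mat n R = mat n n (\<lambda>(a, b).
     if a = b then of_nat (card {c. c < n \<and> R a c}) else - of_bool (R a b))"

text \<open>The cofactor does not see row \<open>i\<close>, so that row may be replaced by a unit
  vector; Laplace expansion along the new row leaves only this cofactor.\<close>

lemma cofactor_eq_det_unit_row:
  assumes A: "A \<in> carrier_mat n n" and i: "i < n" and j: "j < n"
  shows "cofactor A i j = det (mat n n (\<lambda>(a, b). if a = i then of_bool (b = j) else A $$ (a, b)))"
    (is "_ = det ?B")
proof -
  have "mat_delete ?B i j = mat_delete A i j"
    using A i j by (intro eq_matI) (auto simp: mat_delete_def)
  then have "cofactor A i j = cofactor ?B i j" by (simp add: cofactor_def)
  also have "\<dots> = (\<Sum>b<n. if b = j then cofactor ?B i b else 0)" using j by simp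
  also have "\<dots> = (\<Sum>b<n. ?B $$ (i, b) * cofactor ?B i b)"
    using i by (intro sum.cong) auto
  also have "\<dots> = det ?B" using i by (intro laplace_expansion_row[symmetric]) auto
  finally show ?thesis .
qed

lemma cofactor_laplacian_mat:
  assumes i: "i < n" and j: "j < n" and irr: "\<And>a. \<not> R a a"
  shows "cofactor (laplacian_mat n R) i j = (of_nat (card (parent_maps {0..<n} R i)) :: 'a :: idom)"
proof -
  let ?L = "laplacian_mat n R :: 'a mat"
  \<comment> \<open>\<open>row a c\<close> is the contribution of the choice \<open>f a = c\<close>
    to row \<open>a\<close>. The unit row \<open>i\<close> is carried entirely by
    \<open>c = i\<close>, and a non-neighbour contributes a zero row, so the expansion may range
    over all functions.\<close>
  define row where "row a c = vec n (\<lambda>b.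
    if a = i then of_bool (c = i \<and> b = j)
    else if R a c then of_bool (b = a) - of_bool (b = c) else (0 :: 'a))" for a c
  \<comment> \<open>The index set of the multilinear expansion. Its functions are the identity
    outside \<open>{0..<n}\<close>, the same convention as in \<open>parent_maps\<close>.\<close>
  define FS where "FS = {f. (\<forall>a\<in>{0..<n}. f a \<in> {0..<n}) \<and> (\<forall>a. a \<notin> {0..<n} \<longrightarrow> f a = a)}"
  define P where "P = parent_maps {0..<n} R i"
  have dim: "row a c \<in> carrier_vec n" for a c by (simp add: row_def)
  have row_sum: "(\<Sum>c = 0..<n. row a c $ b) = (if a = i then of_bool (b = j) else ?L $$ (a, b))"
    if "a < n" "b < n" for a b
  proof (cases "a = i")
    case True
    then have "(\<Sum>c = 0..<n. row a c $ b) = (\<Sum>c = 0..<n. if c = i then of_bool (b = j) else 0)"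
      using that by (intro sum.cong) (auto simp: row_def)
    then show ?thesis using True i by simp
  next
    case False
    then have "(\<Sum>c = 0..<n. row a c $ b) =
        (\<Sum>c = 0..<n. of_bool (b = a) * of_bool (R a c) - (if c = b then of_bool (R a c) else 0))"
      using that by (intro sum.cong) (auto simp: row_def)
    also have "\<dots> = of_bool (b = a) * of_nat (card {c. c < n \<and> R a c}) - of_bool (R a b)"
    proof -
      have "{0..<n} \<inter> {c. R a c} = {c. c < n \<and> R a c}" by auto
      then show ?thesis using that
        by (simp add: sum_subtractf sum_distrib_left[symmetric] sum_of_bool_eq)
    qed
    finally show ?thesis using False that irr by (auto simp: laplacian_mat_def)
  qed
  have "cofactor ?L i j = det (mat n n (\<lambda>(a, b). if a = i then of_bool (b = j) else ?L $$ (a, b)))"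
    using i j by (intro cofactor_eq_det_unit_row) (auto simp: laplacian_mat_def)
  also have "mat n n (\<lambda>(a, b). if a = i then of_bool (b = j) else ?L $$ (a, b)) =
      mat\<^sub>r n n (\<lambda>a. finsum_vec TYPE('a) n (row a) {0..<n})"
    by (intro eq_matI) (auto simp: row_sum index_finsum_vec dim)
  also have "det \<dots> = (\<Sum>f\<in>FS. det (mat\<^sub>r n n (\<lambda>a. row a (f a))))"
    unfolding FS_def by (rule det_linear_rows_sum) (auto simp: dim)
  also have "\<dots> = (\<Sum>f\<in>FS. of_bool (f \<in> P))"
  proof (rule sum.cong[OF refl])
    fix f assume f: "f \<in> FS"
    then have fn: "\<forall>a<n. f a < n" by (auto simp: FS_def)
    show "det (mat\<^sub>r n n (\<lambda>a. row a (f a))) = of_bool (f \<in> P)"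
    proof (cases "f i = i \<and> (\<forall>a<n. a \<noteq> i \<longrightarrow> R a (f a))")
      case True
      then have M: "mat\<^sub>r n n (\<lambda>a. row a (f a)) = functional_mat n i j f"
        by (intro eq_matI) (auto simp: row_def functional_mat_def)
      show ?thesis
      proof (cases "\<forall>a<n. \<exists>k. (f ^^ k) a = i")
        case reach: True
        then have "f \<in> P" using f fn True by (auto simp: P_def parent_maps_def FS_def)
        then show ?thesis using det_functional_mat_reaching[OF i reach fn j] by (simp add: M)
      next
        case False
        then have "f \<notin> P" by (auto simp: P_def parent_maps_def)
        then show ?thesis using det_functional_mat_not_reaching[OF i fn _ _ j] False by (auto simp: M)
      qed
    next
      case False
      then have "f \<notin> P" by (auto simp: P_def parent_maps_def)
      \<comment> \<open>A choice that moves \<open>i\<close> or picks a non-neighbour somewhere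
        produces a zero row.\<close>
      obtain a where a: "a < n" "row a (f a) = 0\<^sub>v n"
      proof (cases "f i = i")
        case True
        then obtain a where "a < n" "a \<noteq> i" "\<not> R a (f a)" using False by blast
        then show ?thesis by (intro that[of a]) (auto simp: row_def)
      next
        case False
        then show ?thesis using i by (intro that[of i]) (auto simp: row_def)
      qed
      have "mat\<^sub>r n n (\<lambda>b. row b (f b)) = mat\<^sub>r n n (\<lambda>b. if b = a then 0\<^sub>v n else row b (f b))"
        using a by (intro eq_matI) auto
      then have "det (mat\<^sub>r n n (\<lambda>b. row b (f b))) = 0" by (simp add: det_row_0[OF a(1)] dim)
      then show ?thesis using \<open>f \<notin> P\<close> by simp
    qed
  qed
  also have "\<dots> = of_nat (card P)"
  proof -
    have "finite FS" unfolding FS_def by (intro finite_bounded_functions) auto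
    moreover have "P \<subseteq> FS"
    proof
      fix f assume "f \<in> P"
      then have "f a < n" if "a < n" for a using that i
        by (cases "a = i") (auto simp: P_def parent_maps_def)
      then show "f \<in> FS" using \<open>f \<in> P\<close> by (auto simp: P_def parent_maps_def FS_def)
    qed
    ultimately show ?thesis by (simp add: sum_of_bool_eq Int_absorb1)
  qed
  finally show ?thesis by (simp add: P_def)
qed

section \<open>Scaling rows and columns by unimodular factors\<close>

text \<open>Every term of the Leibniz formula uses each row and each column once, so it collects
  every factor once.\<close>

lemma det_scale_rows_cols:
  assumes A: "A \<in> carrier_mat n n" and B: "B \<in> carrier_mat n n"
    and eq: "\<And>a b. a < n \<Longrightarrow> b < n \<Longrightarrow> B $$ (a, b) = c a * A $$ (a, b) * d b"
  shows "det B = (\<Prod>a = 0..<n. c a) * (\<Prod>a = 0..<n. d a) * det A"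
proof -
  have "(\<Prod>a = 0..<n. B $$ (a, q a)) =
      (\<Prod>a = 0..<n. c a) * (\<Prod>a = 0..<n. d a) * (\<Prod>a = 0..<n. A $$ (a, q a))"
    if q: "q permutes {0..<n}" for q
  proof -
    have "q a < n" if "a < n" for a using permutes_in_image[OF q, of a] that by simp
    then have "(\<Prod>a = 0..<n. B $$ (a, q a)) = (\<Prod>a = 0..<n. c a * A $$ (a, q a) * d (q a))"
      by (intro prod.cong) (auto simp: eq)
    also have "\<dots> = (\<Prod>a = 0..<n. c a) * (\<Prod>a = 0..<n. A $$ (a, q a)) * (\<Prod>a = 0..<n. d (q a))"
      by (simp add: prod.distrib)
    also have "(\<Prod>a = 0..<n. d (q a)) = (\<Prod>a = 0..<n. d a)"
      using prod.permute[OF q, of d] by (simp add: o_def)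
    finally show ?thesis by (simp add: mult_ac)
  qed
  then show ?thesis
    unfolding det_def'[OF A] det_def'[OF B] by (auto simp: sum_distrib_left mult_ac intro!: sum.cong)
qed

text \<open>After deleting row \<open>i\<close> and column \<open>j\<close>, the row and column
  factors run over different index sets. Even for conjugate factors the products need not cancel,
  but they have modulus 1. \<open>insert_index\<close> recovers the original index from that of the
  minor.\<close>

lemma cmod_cofactor_scale:
  fixes A B :: "complex mat"
  assumes A: "A \<in> carrier_mat n n" and B: "B \<in> carrier_mat n n" and i: "i < n" and j: "j < n"
    and eq: "\<And>a b. a < n \<Longrightarrow> b < n \<Longrightarrow> B $$ (a, b) = c a * A $$ (a, b) * d b"
    and unit: "\<And>a. cmod (c a) = 1" "\<And>a. cmod (d a) = 1"
  shows "cmod (cofactor B i j) = cmod (cofactor A i j)"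
proof -
  obtain m where n: "n = Suc m" using i by (cases n) auto
  have "det (mat_delete B i j) = (\<Prod>a = 0..<m. c (insert_index i a)) *
      (\<Prod>a = 0..<m. d (insert_index j a)) * det (mat_delete A i j)"
  proof (rule det_scale_rows_cols)
    show "mat_delete A i j \<in> carrier_mat m m" "mat_delete B i j \<in> carrier_mat m m"
      using A B n by auto
    show "mat_delete B i j $$ (a, b) =
        c (insert_index i a) * mat_delete A i j $$ (a, b) * d (insert_index j b)"
      if "a < m" "b < m" for a b
      using that A B i j n by (auto simp: mat_delete_def insert_index_def eq)
  qed
  then show ?thesis by (simp add: cofactor_def norm_mult prod_norm[symmetric] unit norm_power)
qed

section \<open>Property SP as a potential with values in the powers of omega\<close>

lemma cmod_omega: "cmod omega = 1"
  by (simp add: omega_def cmod_def power_divide)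

text \<open>\<open>omega\<close> is a root of \<open>x^2 - x + 1\<close>, hence its cube is
  -1.\<close>

lemma omega_power_6: "omega ^ 6 = 1"
proof -
  have s: "complex_of_real (sqrt 3) * complex_of_real (sqrt 3) = 3"
    by (metis of_real_mult of_real_numeral real_sqrt_mult_self abs_numeral)
  have sq: "omega ^ 2 = omega - 1"
    using s by (simp add: omega_def power2_eq_square field_simps)
  have "omega ^ 3 = omega * omega ^ 2" by (simp add: power3_eq_cube power2_eq_square)
  also have "\<dots> = omega ^ 2 - omega" by (simp add: sq right_diff_distrib flip: power2_eq_square)
  also have "\<dots> = -1" by (simp add: sq)
  finally have "(omega ^ 3) ^ 2 = 1" by simp
  then show ?thesis by (simp flip: power_mult)
qed

text \<open>Give the vertices of part \<open>k\<close> the value \<open>omega ^ k\<close>. Each arc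
  then multiplies by \<open>omega\<close>, and the arcs from part 6 back to part 1 are consistent
  because \<open>omega ^ 6 = 1\<close>.\<close>

lemma unimodular_of_SP:
  assumes "property_SP V E A"
  obtains c :: "'a \<Rightarrow> complex" where "\<And>v. cmod (c v) = 1"
    and "\<And>u v. undirected_edge E A u v \<Longrightarrow> c u = c v"
    and "\<And>u v. (u, v) \<in> A \<Longrightarrow> c v = omega * c u"
proof -
  obtain P :: "nat \<Rightarrow> 'a set" where dis: "disjoint_family_on P {1..6}"
    and un: "\<And>u v. undirected_edge E A u v \<Longrightarrow> \<exists>k\<in>{1..6}. u \<in> P k \<and> v \<in> P k"
    and ar: "\<And>u v. (u, v) \<in> A \<Longrightarrow> (\<exists>k\<in>{1..5}. u \<in> P k \<and> v \<in> P (k + 1)) \<or> u \<in> P 6 \<and> v \<in> P 1"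
    using assms unfolding property_SP_def by blast
  \<comment> \<open>Disjointness makes the index unique. A point in no part gets an arbitrary
    exponent, which still yields modulus 1.\<close>
  define part where "part v = (SOME k. k \<in> {1..6} \<and> v \<in> P k)" for v
  have part: "part v = k" if "v \<in> P k" "k \<in> {1..6}" for v k
    unfolding part_def using that disjoint_family_onD[OF dis]
    by (intro some_equality) blast+
  show ?thesis
  proof (rule that[of "\<lambda>v. omega ^ part v"])
    show "cmod (omega ^ part v) = 1" for v by (simp add: norm_power cmod_omega)
    show "omega ^ part u = omega ^ part v" if "undirected_edge E A u v" for u v
      using un[OF that] part by metis
    show "omega ^ part v = omega * omega ^ part u" if "(u, v) \<in> A" for u v
      using ar[OF that]
    proof
      assume "\<exists>k\<in>{1..5}. u \<in> P k \<and> v \<in> P (k + 1)"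
      then obtain k where k: "k \<in> {1..5}" "u \<in> P k" "v \<in> P (k + 1)" by blast
      then have "part u = k" "part v = k + 1" by (auto intro!: part)
      then show ?thesis by simp
    next
      assume "u \<in> P 6 \<and> v \<in> P 1"
      then have "part u = 6" "part v = 1" by (auto intro!: part)
      then show ?thesis by (simp add: omega_power_6)
    qed
  qed
qed

section \<open>Comparison of the two Laplacians\<close>

text \<open>An edge at a vertex is determined by its other end. This matches the edge count on the
  diagonal with the neighbour count in \<open>laplacian_mat\<close>.\<close>

lemma vertex_degree_nth:
  assumes dist: "distinct vs" and G: "simple_graph (set vs) E" and a: "a < length vs"
  shows "vertex_degree E (vs ! a) = card {b. b < length vs \<and> {vs ! a, vs ! b} \<in> E}"
proof -
  have "bij_betw (\<lambda>b. {vs ! a, vs ! b}) {b. b < length vs \<and> {vs ! a, vs ! b} \<in> E} {e \<in> E. vs ! a \<in> e}"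
  proof (rule bij_betwI')
    show "{vs ! a, vs ! b} = {vs ! a, vs ! c} \<longleftrightarrow> b = c"
      if "b \<in> {b. b < length vs \<and> {vs ! a, vs ! b} \<in> E}" "c \<in> {b. b < length vs \<and> {vs ! a, vs ! b} \<in> E}"
      for b c
      using that dist by (auto simp: doubleton_eq_iff nth_eq_iff_index_eq)
    show "\<exists>b\<in>{b. b < length vs \<and> {vs ! a, vs ! b} \<in> E}. e = {vs ! a, vs ! b}"
      if "e \<in> {e \<in> E. vs ! a \<in> e}" for e
    proof -
      have e: "e \<in> E" "vs ! a \<in> e" "e \<subseteq> set vs" "card e = 2"
        using that G by (auto simp: simple_graph_def)
      then obtain x y where "e = {x, y}" by (meson card_2_iff)
      then obtain w where w: "e = {vs ! a, w}" using e(2) by auto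
      then obtain b where "b < length vs" "w = vs ! b" using e(3) by (auto simp: in_set_conv_nth)
      then show ?thesis using w e(1) by auto
    qed
  qed auto
  then show ?thesis by (simp add: vertex_degree_def bij_betw_same_card)
qed

theorem theorem3p7:
  fixes vs :: "'a list" and E :: "'a set set" and A :: "('a \<times> 'a) set"
  assumes "distinct vs"
    and "simple_graph (set vs) E"
    and "graph_connected (set vs) E"
    and "mixed_graph E A"
    and "property_SP (set vs) E A"
  shows "\<forall>i<length vs. \<forall>j<length vs.
    cmod (cofactor (hermitian_laplacian_2 vs E A) i j) = real (card (spanning_trees (set vs) E))"
proof (intro allI impI)
  fix i j assume i: "i < length vs" and j: "j < length vs"
  let ?n = "length vs" and ?H = "hermitian_laplacian_2 vs E A"
  define R where "R a b \<longleftrightarrow> {vs ! a, vs ! b} \<in> E" for a b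
  let ?L = "laplacian_mat ?n R :: complex mat"
  obtain c :: "'a \<Rightarrow> complex" where c: "\<And>v. cmod (c v) = 1"
    and c_und: "\<And>u v. undirected_edge E A u v \<Longrightarrow> c u = c v"
    and c_arc: "\<And>u v. (u, v) \<in> A \<Longrightarrow> c v = omega * c u"
    using unimodular_of_SP[OF assms(5)] by blast
  have cc: "cnj (c v) * c v = 1" "c v * cnj (c v) = 1" for v
    using complex_norm_square[of "c v"] c[of v] by (simp_all add: mult.commute)
  have noloop: "{v} \<notin> E" for v using assms(2) by (auto simp: simple_graph_def)
  have irr: "\<not> R a a" for a using noloop by (simp add: R_def)
  have AE: "{u, v} \<in> E" "{v, u} \<in> E" "(v, u) \<notin> A" if "(u, v) \<in> A" for u v
    using that assms(4) by (auto simp: mixed_graph_def insert_commute)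
  \<comment> \<open>Entrywise form of the similarity by the diagonal matrix of the values
    \<open>c\<close>. Along an arc from \<open>u\<close> to \<open>v\<close>,
    \<open>cnj (c u) * c v\<close> is \<open>omega\<close> times the squared modulus of
    \<open>c u\<close>, which is 1.\<close>
  have entry: "?H $$ (a, b) = cnj (c (vs ! a)) * ?L $$ (a, b) * c (vs ! b)"
    if ab: "a < ?n" "b < ?n" for a b
  proof (cases "a = b")
    case True
    have "\<not> undirected_edge E A (vs ! a) (vs ! a)" "(vs ! a, vs ! a) \<notin> A"
      using noloop AE[of "vs ! a" "vs ! a"] by (auto simp: undirected_edge_def)
    then have "?H $$ (a, b) = of_nat (vertex_degree E (vs ! a))"
      using ab True by (simp add: hermitian_laplacian_2_def degree_matrix_def hermitian_adjacency_2_def)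
    also have "\<dots> = ?L $$ (a, b)"
      using ab True vertex_degree_nth[OF assms(1,2) ab(1)] by (simp add: laplacian_mat_def R_def)
    finally show ?thesis using True cc by (simp add: mult_ac)
  next
    case False
    have H: "?H $$ (a, b) = - (if undirected_edge E A (vs ! a) (vs ! b) then 1
        else if (vs ! a, vs ! b) \<in> A then omega else if (vs ! b, vs ! a) \<in> A then cnj omega else 0)"
      using ab False by (simp add: hermitian_laplacian_2_def degree_matrix_def hermitian_adjacency_2_def)
    have L: "?L $$ (a, b) = - of_bool (R a b)" using ab False by (simp add: laplacian_mat_def)
    consider (und) "undirected_edge E A (vs ! a) (vs ! b)" | (out) "(vs ! a, vs ! b) \<in> A"
      | (inc) "(vs ! b, vs ! a) \<in> A" | (none) "\<not> R a b"
      by (auto simp: undirected_edge_def R_def)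
    then show ?thesis
    proof cases
      case und
      then have "R a b" by (simp add: R_def undirected_edge_def)
      then show ?thesis using und c_und[OF und] cc by (simp add: H L)
    next
      case out
      then have "R a b" "\<not> undirected_edge E A (vs ! a) (vs ! b)"
        using AE by (auto simp: R_def undirected_edge_def)
      moreover have "cnj (c (vs ! a)) * c (vs ! b) = omega"
        using cc by (simp add: c_arc[OF out] mult.left_commute)
      ultimately show ?thesis using out by (simp add: H L)
    next
      case inc
      \<comment> \<open>The adjacency matrix tests the outgoing arc first, so it must be excluded
        here; a mixed graph never contains both directions.\<close>
      then have "R a b" "\<not> undirected_edge E A (vs ! a) (vs ! b)" "(vs ! a, vs ! b) \<notin> A"
        using AE by (auto simp: R_def undirected_edge_def)
      moreover have "cnj (c (vs ! a)) * c (vs ! b) = cnj omega"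
        using cc by (simp add: c_arc[OF inc] mult.assoc)
      ultimately show ?thesis using inc by (simp add: H L)
    next
      case none
      then have "\<not> undirected_edge E A (vs ! a) (vs ! b)" "(vs ! a, vs ! b) \<notin> A" "(vs ! b, vs ! a) \<notin> A"
        using AE by (auto simp: R_def undirected_edge_def)
      then show ?thesis using none by (simp add: H L)
    qed
  qed
  have "cmod (cofactor ?H i j) = cmod (cofactor ?L i j)"
  proof (rule cmod_cofactor_scale[OF _ _ i j entry])
    show "?L \<in> carrier_mat ?n ?n" by (simp add: laplacian_mat_def)
    show "?H \<in> carrier_mat ?n ?n"
      by (intro carrier_matI)
        (simp_all add: hermitian_laplacian_2_def degree_matrix_def hermitian_adjacency_2_def)
  qed (simp_all add: c)
  also have "\<dots> = card (parent_maps {0..<?n} R i)"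
    using cofactor_laplacian_mat[OF i j, of R, where 'a = complex] irr by simp
  also have "card (parent_maps {0..<?n} R i) =
      card (parent_maps (set vs) (\<lambda>u v. {u, v} \<in> E) (vs ! i))"
  proof (rule card_parent_maps_cong)
    show "bij_betw ((!) vs) {0..<?n} (set vs)"
      using bij_betw_nth[OF assms(1)] by (simp add: atLeast0LessThan)
  qed (use i in \<open>auto simp: R_def\<close>)
  also have "\<dots> = card (spanning_trees (set vs) E)"
    using bij_betw_parent_edges[OF assms(2), of "vs ! i"] i by (intro bij_betw_same_card) auto
  finally show "cmod (cofactor ?H i j) = real (card (spanning_trees (set vs) E))" .
qed

end
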